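(* Let $a$ and $b$ be two streams, each summarized by an ECM-sketch with the same parameters $\epsilon_{cm},\delta_{cm},\epsilon_{sw}$ and the same hash functions, the counters being exponential histograms with error parameter $\epsilon_{sw}$. For a query range $r$ within the sliding window, $$\left|\widehat{a_r\odot b_r}-a_r\odot b_r\right|\ \ge\ \left(\epsilon_{sw}^2+2\epsilon_{sw}+\epsilon_{cm}(1+\epsilon_{sw})^2\right)\|a_r\|_1\,\|b_r\|_1$$ holds with probability at most $\delta=\delta_{cm}$.
   Context: A stream is a sequence of item arrivals from a domain $\mathcal D$ (each arrival contributes one unit). A sliding window of length $N$ covers either the last $N$ time units (time-based) or the last $N$ arrivals (count-based). For a query range $r$ within the window (in time units or arrivals, respectively) and a stream $a$, $a_r$ is the substream of $a$ within the query range, $f_a(x,r)$ is the frequency of item $x$ in $a_r$, and $\|a_r\|_1$ is the number of arrivals in $a_r$; similarly for $b$. The inner product is $a_r\odot b_r=\sum_{x\in\mathcal D}f_a(x,r)f_b(x,r)$. ECM-sketch: let $w=\lceil e/\epsilon_{cm}\rceil$ (with $e$ the base of the natural logarithm) and $d=\lceil\ln(1/\delta_{cm})\rceil$. The sketch is a Count-Min sketch with $d$ hash functions $h_1,\dots,h_d:\mathcal D\to\{1,\dots,w\}$, drawn independently from a pairwise-independent family, and a $w\times d$ array of counters, in which each counter is replaced by a sliding-window structure. On each arrival of an item $x$, for every $j\in\{1,\dots,d\}$ the arrival is registered in counter $(h_j(x),j)$. Each counter is an exponential histogram with error parameter $\epsilon_{sw}$, a deterministic structure whose estimate for any query range within the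 window is within a factor $(1\pm\epsilon_{sw})$ of the true number of arrivals registered in that counter within the range. $E_a(i,j,r)$ denotes the estimated value of counter $(i,j)$ of the sketch of $a$ for query range $r$; similarly $E_b(i,j,r)$ for $b$. The probability is over the choice of the hash functions. The inner-product estimate is $\widehat{a_r\odot b_r}=\min_{1\le j\le d}\sum_{i=1}^{w}E_a(i,j,r)\,E_b(i,j,r)$.
   Formalization: Both substreams a_r and b_r are assumed to be nonempty: if either is empty, the estimate, the inner product and the error bound are all 0, so the event "≥" holds with probability 1 and the printed claim fails. *)

theory Defs
  imports "HOL-Probability.Probability" "HOL-Library.Groups_Big_Fun"
begin

text \<open>
  A stream up to the present is the finite list of its arrivals (arrival time and item), oldest
  first. The item domain is the whole type \<open>'x\<close>, which may be infinite. Every arrival carries a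
  stamp: its sequence number within the stream, counted from 1, and its arrival time. The clock of
  a stream is the pair of the number of arrivals so far and the current time.
\<close>

type_synonym 'x arrivals = "(real \<times> 'x) list"
type_synonym stamp = "nat \<times> real"

definition stream_until :: "real \<Rightarrow> 'x arrivals \<Rightarrow> bool" where
  "stream_until now a \<longleftrightarrow> sorted (map fst a) \<and> (\<forall>(t, x) \<in> set a. t \<le> now)"

definition clock :: "real \<Rightarrow> 'x arrivals \<Rightarrow> stamp" where
  "clock now a = (length a, now)"

definition stamped :: "'x arrivals \<Rightarrow> (stamp \<times> 'x) list" where
  "stamped a = map (\<lambda>k. ((Suc k, fst (a ! k)), snd (a ! k))) [0..<length a]"

text \<open>Window lengths and query ranges: time-based or count-based.\<close>

datatype extent = Time_Units real | Arrivals nat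

fun within_window :: "extent \<Rightarrow> extent \<Rightarrow> bool" where
  "within_window (Time_Units N) (Time_Units r) \<longleftrightarrow> 0 < r \<and> r \<le> N"
| "within_window (Arrivals N) (Arrivals r) \<longleftrightarrow> 0 < r \<and> r \<le> N"
| "within_window _ _ \<longleftrightarrow> False"

text \<open>
  At clock \<open>(n, now)\<close>, the last \<open>r\<close> time units are the half-open interval from \<open>now - r\<close> (excluded)
  to \<open>now\<close>, and the last \<open>r\<close> arrivals are those numbered \<open>n - r + 1, \<dots>, n\<close>.
\<close>

fun in_range :: "stamp \<Rightarrow> extent \<Rightarrow> stamp \<Rightarrow> bool" where
  "in_range (n, now) (Time_Units r) (k, t) \<longleftrightarrow> now - r < t"
| "in_range (n, now) (Arrivals r) (k, t) \<longleftrightarrow> n < k + r"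

definition substream :: "real \<Rightarrow> 'x arrivals \<Rightarrow> extent \<Rightarrow> 'x list" where
  "substream now a r = map snd (filter (\<lambda>(s, x). in_range (clock now a) r s) (stamped a))"

definition freq :: "real \<Rightarrow> 'x arrivals \<Rightarrow> 'x \<Rightarrow> extent \<Rightarrow> nat" where
  "freq now a x r = count_list (substream now a r) x"

definition norm1 :: "real \<Rightarrow> 'x arrivals \<Rightarrow> extent \<Rightarrow> nat" where
  "norm1 now a r = length (substream now a r)"

text \<open>\<^const>\<open>Sum_any\<close> sums over the whole domain; only finitely many terms are nonzero.\<close>

definition inner_product :: "real \<Rightarrow> 'x arrivals \<Rightarrow> 'x arrivals \<Rightarrow> extent \<Rightarrow> nat" where
  "inner_product now a b r = Sum_any (\<lambda>x. freq now a x r * freq now b x r)"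

text \<open>
  A sliding-window counter is a deterministic structure, represented by its estimate as a function
  of the stamps of the arrivals registered in it (oldest first), the clock of the stream, and the
  query range. In a count-based window the sequence numbers and the range refer to all arrivals of
  the stream, not only to those registered in the counter.
\<close>

type_synonym sw_counter = "stamp list \<Rightarrow> stamp \<Rightarrow> extent \<Rightarrow> real"

definition valid_history :: "stamp list \<Rightarrow> stamp \<Rightarrow> bool" where
  "valid_history ss c \<longleftrightarrow>
     sorted_wrt (\<lambda>s s'. fst s < fst s' \<and> snd s \<le> snd s') ss \<and>
     (\<forall>s \<in> set ss. 1 \<le> fst s \<and> fst s \<le> fst c \<and> snd s \<le> snd c)"

text \<open>
  The property of an exponential histogram with error parameter \<open>\<epsilon>\<close> and window length \<open>N\<close>: every
  estimate within the window is within a factor \<open>1 \<plusminus> \<epsilon>\<close> of the true number of registered arrivals.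
\<close>

definition exponential_histogram :: "real \<Rightarrow> extent \<Rightarrow> sw_counter \<Rightarrow> bool" where
  "exponential_histogram \<epsilon> N est \<longleftrightarrow>
     (\<forall>ss c r. valid_history ss c \<longrightarrow> within_window N r \<longrightarrow>
        (let n = real (length (filter (in_range c r) ss))
         in (1 - \<epsilon>) * n \<le> est ss c r \<and> est ss c r \<le> (1 + \<epsilon>) * n))"

text \<open>
  A pairwise-independent family of hash functions into \<open>{1..w}\<close>, as the distribution of a random
  member. As usual for hash families, this includes that each single hash value is uniform.
\<close>

definition pairwise_independent_family :: "nat \<Rightarrow> ('x \<Rightarrow> nat) measure \<Rightarrow> bool" where
  "pairwise_independent_family w F \<longleftrightarrow>
     prob_space F \<and>
     (\<forall>h \<in> space F. \<forall>x. h x \<in> {1..w}) \<and>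
     (\<forall>x. (\<lambda>h. h x) \<in> F \<rightarrow>\<^sub>M count_space UNIV) \<and>
     (\<forall>x. \<forall>i \<in> {1..w}. \<P>(h in F. h x = i) = 1 / real w) \<and>
     (\<forall>x y. x \<noteq> y \<longrightarrow>
        prob_space.indep_var F (count_space UNIV) (\<lambda>h. h x) (count_space UNIV) (\<lambda>h. h y))"

definition sketch_width :: "real \<Rightarrow> nat" where
  "sketch_width \<epsilon>cm = nat \<lceil>exp 1 / \<epsilon>cm\<rceil>"

definition sketch_depth :: "real \<Rightarrow> nat" where
  "sketch_depth \<delta>cm = nat \<lceil>ln (1 / \<delta>cm)\<rceil>"

text \<open>\<open>d\<close> independent draws \<open>h 1, \<dots>, h d\<close> from the family \<open>F\<close>.\<close>

definition hash_draws :: "nat \<Rightarrow> ('x \<Rightarrow> nat) measure \<Rightarrow> (nat \<Rightarrow> 'x \<Rightarrow> nat) measure" where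
  "hash_draws d F = (\<Pi>\<^sub>M j \<in> {1..d}. F)"

definition registered :: "(nat \<Rightarrow> 'x \<Rightarrow> nat) \<Rightarrow> 'x arrivals \<Rightarrow> nat \<Rightarrow> nat \<Rightarrow> stamp list" where
  "registered h a i j = map fst (filter (\<lambda>(s, x). h j x = i) (stamped a))"

definition ecm_counter ::
    "sw_counter \<Rightarrow> (nat \<Rightarrow> 'x \<Rightarrow> nat) \<Rightarrow> real \<Rightarrow> 'x arrivals \<Rightarrow> nat \<Rightarrow> nat \<Rightarrow> extent \<Rightarrow> real" where
  "ecm_counter est h now a i j r = est (registered h a i j) (clock now a) r"

definition inner_product_estimate ::
    "sw_counter \<Rightarrow> nat \<Rightarrow> nat \<Rightarrow> (nat \<Rightarrow> 'x \<Rightarrow> nat) \<Rightarrow> real \<Rightarrow> 'x arrivals \<Rightarrow> 'x arrivals \<Rightarrow>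
     extent \<Rightarrow> real" where
  "inner_product_estimate est w d h now a b r =
     (MIN j \<in> {1..d}. \<Sum>i = 1..w. ecm_counter est h now a i j r * ecm_counter est h now b i j r)"

end

theory Submission
  imports Defs
begin

text \<open>
  For one hash function \<open>h\<close>, the exact counters satisfy \<open>\<Sum>\<^sub>i A\<^sub>i B\<^sub>i = a \<odot> b + X\<close>, where \<open>X\<close> is the
  weight of the pairs of distinct colliding items. Replacing the exact counters by their estimates
  costs at most a factor \<open>1 \<plusminus> (\<epsilon>\<^sup>2 + 2\<epsilon>)\<close>. Since \<open>a \<odot> b + X\<close> never exceeds \<open>\<parallel>a\<parallel> \<parallel>b\<parallel>\<close>, an
  underestimate by the stated amount is impossible, and an overestimate forces
  \<open>X \<ge> \<epsilon>\<^sub>c\<^sub>m \<parallel>a\<parallel> \<parallel>b\<parallel>\<close>. By Markov's inequality this has probability at most \<open>1 / e\<close>, and the minimum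
  fails only if all \<open>d\<close> independent rows fail.
\<close>

section \<open>Colliding pairs in the exact counters\<close>

text \<open>The sums run over a finite \<open>D\<close> because the item domain may be infinite.
  Pairs are ordered: \<open>f\<close> and \<open>g\<close> belong to different streams.\<close>

definition collision_weight :: "('x \<Rightarrow> real) \<Rightarrow> ('x \<Rightarrow> real) \<Rightarrow> 'x set \<Rightarrow> ('x \<Rightarrow> nat) \<Rightarrow> real" where
  "collision_weight f g D h =
     (\<Sum>x\<in>D. \<Sum>y\<in>D. f x * g y * of_bool (x \<noteq> y \<and> h x = h y))"

text \<open>After exchanging the sums, a pair \<open>(x, y)\<close> contributes to a bucket only if
  \<open>h x = h y\<close>, and then to bucket \<open>h x\<close> alone, which lies in
  \<open>{1..w}\<close>. The diagonal is then split off.\<close>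

lemma bucket_products_eq:
  fixes f g :: "'x \<Rightarrow> real" and h :: "'x \<Rightarrow> nat"
  assumes "finite D" and "\<And>x. h x \<in> {1..w}"
  shows "(\<Sum>i=1..w. (\<Sum>x\<in>D. f x * of_bool (h x = i)) * (\<Sum>y\<in>D. g y * of_bool (h y = i)))
           = (\<Sum>x\<in>D. f x * g x) + collision_weight f g D h"
proof -
  have "(\<Sum>i=1..w. (\<Sum>x\<in>D. f x * of_bool (h x = i)) * (\<Sum>y\<in>D. g y * of_bool (h y = i)))
      = (\<Sum>i=1..w. \<Sum>x\<in>D. \<Sum>y\<in>D. f x * g y * of_bool (h x = i \<and> h y = i))"
    by (auto simp: sum_product intro!: sum.cong)
  also have "\<dots> = (\<Sum>x\<in>D. \<Sum>y\<in>D. \<Sum>i=1..w. f x * g y * of_bool (h x = i \<and> h y = i))"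
    by (subst sum.swap, rule sum.cong[OF refl], rule sum.swap)
  also have "\<dots> = (\<Sum>x\<in>D. \<Sum>y\<in>D. f x * g y * of_bool (h x = h y))"
  proof (intro sum.cong refl)
    fix x y
    have "(\<Sum>i=1..w. f x * g y * of_bool (h x = i \<and> h y = i))
        = (\<Sum>i=1..w. if h x = i then f x * g y * of_bool (h x = h y) else 0)"
      by (intro sum.cong) auto
    then show "(\<Sum>i=1..w. f x * g y * of_bool (h x = i \<and> h y = i)) = f x * g y * of_bool (h x = h y)"
      using assms(2)[of x] by simp
  qed
  also have "\<dots> = (\<Sum>x\<in>D. \<Sum>y\<in>D. (if y = x then f x * g x else 0)
                    + f x * g y * of_bool (x \<noteq> y \<and> h x = h y))"
    by (intro sum.cong) auto
  finally show ?thesis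
    using assms(1) by (simp add: sum.distrib collision_weight_def)
qed

lemma collision_weight_nonneg:
  assumes "\<And>x. 0 \<le> f x" and "\<And>x. 0 \<le> g x"
  shows "0 \<le> collision_weight f g D h"
  unfolding collision_weight_def using assms by (intro sum_nonneg) simp

text \<open>Diagonal and colliding pairs are disjoint parts of \<open>D \<times> D\<close>, whose
  total weight is the product of the sums.\<close>

lemma diagonal_plus_collision_weight_le:
  assumes "finite D" and "\<And>x. 0 \<le> f x" and "\<And>x. 0 \<le> g x"
  shows "(\<Sum>x\<in>D. f x * g x) + collision_weight f g D h \<le> sum f D * sum g D"
proof -
  have "(\<Sum>x\<in>D. f x * g x) + collision_weight f g D h
      = (\<Sum>x\<in>D. \<Sum>y\<in>D. (if y = x then f x * g x else 0)
                    + f x * g y * of_bool (x \<noteq> y \<and> h x = h y))"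
    using assms(1) by (simp add: sum.distrib collision_weight_def)
  also have "\<dots> \<le> (\<Sum>x\<in>D. \<Sum>y\<in>D. f x * g y)"
    using assms(2,3) by (intro sum_mono) auto
  finally show ?thesis by (simp add: sum_product)
qed

section \<open>Collision probability and tail bound for one hash function\<close>

lemma hash_eq_measurable:
  assumes "pairwise_independent_family w F"
  shows "{h \<in> space F. h x = h y} \<in> sets F"
proof -
  have m: "(\<lambda>h. h x) \<in> F \<rightarrow>\<^sub>M count_space UNIV" for x
    using assms by (simp add: pairwise_independent_family_def)
  show ?thesis using m[of x] m[of y] by measurable
qed

text \<open>Splitting by the common value gives \<open>w\<close> disjoint events, each of
  probability \<open>1 / w\<close> squared by independence and uniformity.\<close>

lemma collision_probability:
  assumes F: "pairwise_independent_family w F" and xy: "x \<noteq> y"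
  shows "measure F {h \<in> space F. h x = h y} = 1 / real w"
proof -
  interpret prob_space F using F by (simp add: pairwise_independent_family_def)
  have m[measurable]: "(\<lambda>h. h x) \<in> F \<rightarrow>\<^sub>M count_space UNIV" for x
    using F by (simp add: pairwise_independent_family_def)
  have u: "prob {h \<in> space F. h x = i} = 1 / real w" if "i \<in> {1..w}" for x i
    using F that by (simp add: pairwise_independent_family_def)
  have r: "h x \<in> {1..w}" if "h \<in> space F" for x h
    using F that by (simp add: pairwise_independent_family_def)
  have ind: "indep_var (count_space UNIV) (\<lambda>h. h x) (count_space UNIV) (\<lambda>h. h y)"
    using F xy by (simp add: pairwise_independent_family_def)
  have pair: "prob {h \<in> space F. h x = i \<and> h y = i} = (1 / real w)\<^sup>2" if i: "i \<in> {1..w}" for i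
  proof -
    have "prob ((\<lambda>h. (h x, h y)) -` ({i} \<times> {i}) \<inter> space F)
        = prob ((\<lambda>h. h x) -` {i} \<inter> space F) * prob ((\<lambda>h. h y) -` {i} \<inter> space F)"
      by (rule indep_varD[OF ind]) auto
    moreover have "(\<lambda>h. (h x, h y)) -` ({i} \<times> {i}) \<inter> space F = {h \<in> space F. h x = i \<and> h y = i}"
      and "(\<lambda>h. h z) -` {i} \<inter> space F = {h \<in> space F. h z = i}" for z
      by auto
    ultimately show ?thesis using u[OF i] by (simp add: power2_eq_square)
  qed
  \<comment> \<open>A probability space is nonempty, and with \<open>w = 0\<close> a hash value
    would lie in an empty set.\<close>
  obtain h where "h \<in> space F" using not_empty by blast
  then have w: "w \<noteq> 0" using r[of h x] by auto
  have "{h \<in> space F. h x = h y} = (\<Union>i\<in>{1..w}. {h \<in> space F. h x = i \<and> h y = i})"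
    using r by auto
  then have "prob {h \<in> space F. h x = h y} = (\<Sum>i=1..w. prob {h \<in> space F. h x = i \<and> h y = i})"
    by (auto intro!: finite_measure_finite_Union simp: disjoint_family_on_def)
  also have "\<dots> = 1 / real w"
    using pair w by (simp add: power2_eq_square)
  finally show ?thesis .
qed

lemma collision_weight_borel_measurable:
  assumes "pairwise_independent_family w F"
  shows "collision_weight f g D \<in> borel_measurable F"
proof -
  have [measurable]: "(\<lambda>h. h x) \<in> F \<rightarrow>\<^sub>M count_space UNIV" for x
    using assms by (simp add: pairwise_independent_family_def)
  show ?thesis unfolding collision_weight_def[abs_def] by measurable
qed

lemma collision_weight_expectation:
  assumes F: "pairwise_independent_family w F" and D: "finite D"
    and f: "\<And>x. 0 \<le> f x" and g: "\<And>x. 0 \<le> g x"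
  shows "integrable F (collision_weight f g D)"
    and "(LINT h|F. collision_weight f g D h) \<le> sum f D * sum g D / real w"
proof -
  interpret prob_space F using F by (simp add: pairwise_independent_family_def)
  note mF = hash_eq_measurable[OF F]
  let ?B = "\<lambda>x y. {h \<in> space F. h x = h y}"
  \<comment> \<open>Factoring out the constant \<open>of_bool (x \<noteq> y)\<close> leaves the
    indicator of a measurable event.\<close>
  have term_eq: "f x * g y * of_bool (x \<noteq> y \<and> h x = h y)
      = f x * g y * of_bool (x \<noteq> y) * indicator (?B x y) h" if "h \<in> space F" for x y h
    using that by auto
  have int: "integrable F (\<lambda>h. f x * g y * of_bool (x \<noteq> y) * indicator (?B x y) h)" for x y
    using mF[of x y] by (intro integrable_mult_right integrable_real_indicator) (auto simp: emeasure_eq_measure)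
  have eq: "collision_weight f g D h
      = (\<Sum>x\<in>D. \<Sum>y\<in>D. f x * g y * of_bool (x \<noteq> y) * indicator (?B x y) h)"
    if "h \<in> space F" for h
    unfolding collision_weight_def by (intro sum.cong refl term_eq that)
  have "integrable F (\<lambda>h. \<Sum>x\<in>D. \<Sum>y\<in>D. f x * g y * of_bool (x \<noteq> y) * indicator (?B x y) h)"
    by (intro Bochner_Integration.integrable_sum int)
  then show "integrable F (collision_weight f g D)"
    by (subst Bochner_Integration.integrable_cong[OF refl eq]) auto
  have "(LINT h|F. collision_weight f g D h)
      = (\<Sum>x\<in>D. \<Sum>y\<in>D. LINT h|F. f x * g y * of_bool (x \<noteq> y) * indicator (?B x y) h)"
    by (subst Bochner_Integration.integral_cong[OF refl eq], assumption,
        subst Bochner_Integration.integral_sum, intro Bochner_Integration.integrable_sum int,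
        intro sum.cong refl Bochner_Integration.integral_sum int)
  also have "\<dots> = (\<Sum>x\<in>D. \<Sum>y\<in>D. f x * g y * of_bool (x \<noteq> y) * prob (?B x y))"
    using mF by simp
  \<comment> \<open>Equality holds off the diagonal; diagonal terms grow from 0 to
    \<open>f x * g x / w\<close>, so that the sum factorises.\<close>
  also have "\<dots> \<le> (\<Sum>x\<in>D. \<Sum>y\<in>D. f x * g y * (1 / real w))"
    using collision_probability[OF F] f g by (intro sum_mono) auto
  also have "\<dots> = sum f D * sum g D / real w"
    by (simp add: sum_product sum_divide_distrib)
  finally show "(LINT h|F. collision_weight f g D h) \<le> sum f D * sum g D / real w" .
qed

text \<open>Markov's inequality with the mean bound \<open>M / w\<close> gives
  \<open>1 / (\<epsilon> * w)\<close>, which the width makes at most \<open>1 / e\<close>.\<close>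

lemma collision_weight_tail:
  assumes F: "pairwise_independent_family w F" and D: "finite D"
    and f: "\<And>x. 0 \<le> f x" and g: "\<And>x. 0 \<le> g x"
    and \<epsilon>: "0 < \<epsilon>" and w: "exp 1 \<le> \<epsilon> * real w" and M: "0 < sum f D * sum g D"
  shows "measure F {h \<in> space F. \<epsilon> * (sum f D * sum g D) \<le> collision_weight f g D h} \<le> exp (- 1)"
proof -
  interpret prob_space F using F by (simp add: pairwise_independent_family_def)
  let ?M = "sum f D * sum g D"
  have wpos: "0 < real w" using w exp_gt_zero[of 1] by (cases w) (auto simp del: exp_gt_zero)
  have "prob {h \<in> space F. \<epsilon> * ?M \<le> collision_weight f g D h}
      \<le> (LINT h|F. collision_weight f g D h) / (\<epsilon> * ?M)"
    using \<epsilon> M collision_weight_nonneg[of f g, OF f g]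
    by (intro integral_Markov_inequality_measure[where A = "{}"]
          collision_weight_expectation(1)[of w F, OF F D f g]) auto
  also have "\<dots> \<le> (?M / real w) / (\<epsilon> * ?M)"
    using collision_weight_expectation(2)[OF F D f g] \<epsilon> M by (intro divide_right_mono) auto
  also have "\<dots> = 1 / (\<epsilon> * real w)" using M by (auto simp: field_simps)
  also have "\<dots> \<le> 1 / exp 1" using w \<epsilon> wpos by (intro divide_left_mono mult_pos_pos) auto
  finally show ?thesis by (simp add: exp_minus inverse_eq_divide)
qed

section \<open>Choice of width and depth\<close>

lemma exp_le_mult_sketch_width:
  assumes "0 < \<epsilon>"
  shows "exp 1 \<le> \<epsilon> * real (sketch_width \<epsilon>)"
proof -
  have "exp 1 / \<epsilon> \<le> real (sketch_width \<epsilon>)"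
    unfolding sketch_width_def by (rule real_nat_ceiling_ge)
  then show ?thesis using assms by (simp add: pos_divide_le_eq mult.commute)
qed

lemma exp_minus_one_power_sketch_depth_le:
  assumes "0 < \<delta>"
  shows "exp (- 1) ^ sketch_depth \<delta> \<le> \<delta>"
proof -
  have "exp (- 1) ^ sketch_depth \<delta> = exp (- real (sketch_depth \<delta>))"
    by (simp add: exp_of_nat_mult[symmetric])
  also have "\<dots> \<le> exp (- ln (1 / \<delta>))"
    using real_nat_ceiling_ge[of "ln (1 / \<delta>)"] by (simp add: sketch_depth_def)
  also have "\<dots> = \<delta>" using assms by (simp add: ln_div)
  finally show ?thesis .
qed

lemma sketch_depth_pos: "0 < \<delta> \<Longrightarrow> \<delta> < 1 \<Longrightarrow> 0 < sketch_depth \<delta>"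
  by (simp add: sketch_depth_def)

section \<open>Independent rows\<close>

text \<open>The event is a box in the product space, so its probability is the product over the
  rows.\<close>

lemma prob_all_draws:
  assumes "prob_space F" and "A \<in> sets F"
  shows "{h \<in> space (hash_draws d F). \<forall>j\<in>{1..d}. h j \<in> A} \<in> sets (hash_draws d F)"
    and "measure (hash_draws d F) {h \<in> space (hash_draws d F). \<forall>j\<in>{1..d}. h j \<in> A}
           = measure F A ^ d"
proof -
  interpret F: prob_space F by fact
  interpret finite_product_prob_space "\<lambda>_. F" "{1..d}" by unfold_locales auto
  have eq: "{h \<in> space (hash_draws d F). \<forall>j\<in>{1..d}. h j \<in> A} = (\<Pi>\<^sub>E j\<in>{1..d}. A)"
    using sets.sets_into_space[OF assms(2)] by (auto simp: hash_draws_def space_PiM PiE_iff extensional_def simp del: atLeastAtMost_iff)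
  show "{h \<in> space (hash_draws d F). \<forall>j\<in>{1..d}. h j \<in> A} \<in> sets (hash_draws d F)"
    unfolding eq unfolding hash_draws_def using assms(2) by (intro sets_PiM_I_finite) auto
  show "measure (hash_draws d F) {h \<in> space (hash_draws d F). \<forall>j\<in>{1..d}. h j \<in> A}
           = measure F A ^ d"
    unfolding eq unfolding hash_draws_def using assms(2) by (subst prob_times) auto
qed

section \<open>Counters and frequencies\<close>

text \<open>Makes the histogram guarantee applicable: stamps come from the whole stream, and
  filtering preserves their order.\<close>

lemma valid_history_registered:
  assumes "stream_until now a"
  shows "valid_history (registered h a i j) (clock now a)"
proof -
  have "sorted (map fst a)" and le: "\<forall>(t, x) \<in> set a. t \<le> now"
    using assms by (auto simp: stream_until_def)
  then have "fst (a ! k) \<le> fst (a ! l)" if "k < l" "l < length a" for k l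
    using that sorted_nth_mono[of "map fst a" k l] by simp
  then have "sorted_wrt (\<lambda>p q. fst (fst p) < fst (fst q) \<and> snd (fst p) \<le> snd (fst q)) (stamped a)"
    by (auto simp: stamped_def sorted_wrt_iff_nth_less)
  then have "sorted_wrt (\<lambda>s s'. fst s < fst s' \<and> snd s \<le> snd s') (registered h a i j)"
    unfolding registered_def sorted_wrt_map by (rule sorted_wrt_filter)
  moreover have "1 \<le> fst s \<and> fst s \<le> fst (clock now a) \<and> snd s \<le> snd (clock now a)"
    if "s \<in> set (registered h a i j)" for s
  proof -
    have "s \<in> fst ` set (stamped a)"
      using that unfolding registered_def set_map by (rule rev_subsetD) (auto intro: image_mono)
    then obtain k where "k < length a" "s = (Suc k, fst (a ! k))"
      by (auto simp: stamped_def)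
    then show ?thesis using le nth_mem[of k a] by (auto simp: clock_def case_prod_unfold)
  qed
  ultimately show ?thesis by (simp add: valid_history_def)
qed

text \<open>Filtering by range and by hash value commute. \<open>D\<close> may exceed the items of
  one stream, so one set can serve both.\<close>

lemma registered_in_range_eq_freq:
  assumes "finite D" and "set (substream now a r) \<subseteq> D"
  shows "real (length (filter (in_range (clock now a) r) (registered h a i j)))
           = (\<Sum>x\<in>D. real (freq now a x r) * of_bool (h j x = i))"
proof -
  have "length (filter (in_range (clock now a) r) (registered h a i j))
      = length (filter (\<lambda>x. h j x = i) (substream now a r))"
    by (simp add: registered_def substream_def filter_map o_def case_prod_unfold conj_commute)
  also have "\<dots> = (\<Sum>x\<in>D. count_list (filter (\<lambda>x. h j x = i) (substream now a r)) x)"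
    using assms by (intro sum_count_set[symmetric]) auto
  also have "\<dots> = (\<Sum>x\<in>D. freq now a x r * of_bool (h j x = i))"
    by (intro sum.cong refl)
       (auto simp: freq_def count_list_eq_length_filter filter_empty_conv
             intro!: arg_cong[where f = length] filter_cong)
  finally show ?thesis by simp
qed

lemma inner_product_eq_sum:
  assumes "finite D" and "set (substream now a r) \<subseteq> D"
  shows "inner_product now a b r = (\<Sum>x\<in>D. freq now a x r * freq now b x r)"
  unfolding inner_product_def
  using assms by (intro Sum_any.expand_superset) (auto simp: freq_def count_list_0_iff)

text \<open>The source of \<open>\<epsilon>\<^sup>2 + 2 * \<epsilon>\<close>: the product of the two
  deviations gives the square, the two mixed terms give \<open>\<epsilon>\<close> each.\<close>

lemma abs_mult_diff_le:
  fixes p q n m \<epsilon> :: real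
  assumes "0 \<le> \<epsilon>" and "0 \<le> n" and "0 \<le> m"
    and "\<bar>p - n\<bar> \<le> \<epsilon> * n" and "\<bar>q - m\<bar> \<le> \<epsilon> * m"
  shows "\<bar>p * q - n * m\<bar> \<le> (\<epsilon>\<^sup>2 + 2 * \<epsilon>) * (n * m)"
proof -
  have "p * q - n * m = (p - n) * (q - m) + n * (q - m) + (p - n) * m"
    by (simp add: algebra_simps)
  also have "\<bar>\<dots>\<bar> \<le> \<bar>p - n\<bar> * \<bar>q - m\<bar> + n * \<bar>q - m\<bar> + \<bar>p - n\<bar> * m"
    using abs_triangle_ineq[of "(p - n) * (q - m) + n * (q - m)" "(p - n) * m"]
      abs_triangle_ineq[of "(p - n) * (q - m)" "n * (q - m)"] assms(2,3)
    by (simp add: abs_mult)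
  also have "\<dots> \<le> (\<epsilon> * n) * (\<epsilon> * m) + n * (\<epsilon> * m) + (\<epsilon> * n) * m"
    using assms by (intro add_mono mult_mono) auto
  finally show ?thesis by (simp add: power2_eq_square algebra_simps)
qed

section \<open>Failure of the minimum over all rows\<close>

theorem theorem2:
  fixes \<epsilon>cm \<delta>cm \<epsilon>sw now :: real
    and N r :: extent
    and est :: sw_counter
    and F :: "('x \<Rightarrow> nat) measure"
    and a b :: "'x arrivals"
  assumes "0 < \<epsilon>cm" and "0 < \<delta>cm" and "\<delta>cm < 1" and "0 < \<epsilon>sw"
    and "exponential_histogram \<epsilon>sw N est"
    and "pairwise_independent_family (sketch_width \<epsilon>cm) F"
    and "stream_until now a" and "stream_until now b"
    and "within_window N r"
    and "substream now a r \<noteq> []" and "substream now b r \<noteq> []"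
  shows "\<P>(h in hash_draws (sketch_depth \<delta>cm) F.
      \<bar>inner_product_estimate est (sketch_width \<epsilon>cm) (sketch_depth \<delta>cm) h now a b r
         - real (inner_product now a b r)\<bar>
      \<ge> (\<epsilon>sw\<^sup>2 + 2 * \<epsilon>sw + \<epsilon>cm * (1 + \<epsilon>sw)\<^sup>2) * real (norm1 now a r) * real (norm1 now b r))
    \<le> \<delta>cm"
proof -
  define w where "w = sketch_width \<epsilon>cm"
  define d where "d = sketch_depth \<delta>cm"
  define D where "D = set (substream now a r) \<union> set (substream now b r)"
  define f where "f x = real (freq now a x r)" for x
  define g where "g x = real (freq now b x r)" for x
  define M where "M = sum f D * sum g D"
  define I where "I = (\<Sum>x\<in>D. f x * g x)"
  define X where "X = collision_weight f g D"
  define c where "c = \<epsilon>sw\<^sup>2 + 2 * \<epsilon>sw"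
  define t where "t = (c + \<epsilon>cm * (1 + \<epsilon>sw)\<^sup>2) * M"
  define S where "S h j = (\<Sum>i = 1..w. ecm_counter est h now a i j r * ecm_counter est h now b i j r)"
    for h j
  \<comment> \<open>The bad hash functions for a single row.\<close>
  define A where "A = {k \<in> space F. \<epsilon>cm * M \<le> X k}"
  have F: "pairwise_independent_family w F" using assms(6) by (simp add: w_def)
  then have pF: "prob_space F" by (simp add: pairwise_independent_family_def)
  have D: "finite D" "set (substream now a r) \<subseteq> D" "set (substream now b r) \<subseteq> D"
    by (auto simp: D_def)
  have f: "0 \<le> f x" and g: "0 \<le> g x" for x by (auto simp: f_def g_def)
  have norms: "sum f D = real (norm1 now a r)" "sum g D = real (norm1 now b r)"
    using sum_count_set[OF D(2,1)] sum_count_set[OF D(3,1)]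
    by (simp_all add: f_def g_def freq_def norm1_def flip: of_nat_sum)
  \<comment> \<open>Nonempty substreams matter here: for \<open>M = 0\<close> the threshold would be
    0 and always reached.\<close>
  have M: "0 < M" using assms(10,11) by (simp add: M_def norms norm1_def)
  have I: "real (inner_product now a b r) = I"
    by (simp add: I_def f_def g_def inner_product_eq_sum[OF D(1,2)])
  have c: "0 < c" using assms(4) by (simp add: c_def add_pos_pos)
  have c1: "1 + c = (1 + \<epsilon>sw)\<^sup>2" by (simp add: c_def power2_eq_square algebra_simps)
  \<comment> \<open>At least one row, so the minimum ranges over a nonempty set.\<close>
  have d: "0 < d" using assms(2,3) by (simp add: d_def sketch_depth_pos)

  \<comment> \<open>The error of each bucket is relative to \<open>n i * m i\<close>, and these
    products sum to \<open>I + X (h j)\<close>.\<close>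
  have row: "\<bar>S h j - (I + X (h j))\<bar> \<le> c * (I + X (h j))" if hj: "h j \<in> space F" for h j
  proof -
    define n where "n i = (\<Sum>x\<in>D. f x * of_bool (h j x = i))" for i
    define m where "m i = (\<Sum>x\<in>D. g x * of_bool (h j x = i))" for i
    have T: "(\<Sum>i=1..w. n i * m i) = I + X (h j)"
      unfolding n_def m_def I_def X_def using F hj
      by (intro bucket_products_eq D(1)) (simp add: pairwise_independent_family_def)
    have "\<bar>ecm_counter est h now a i j r * ecm_counter est h now b i j r - n i * m i\<bar>
        \<le> c * (n i * m i)" for i
      unfolding c_def
    proof (rule abs_mult_diff_le)
      show "0 \<le> \<epsilon>sw" "0 \<le> n i" "0 \<le> m i"
        using assms(4) f g by (auto simp: n_def m_def intro!: sum_nonneg)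
      have cnt: "\<bar>ecm_counter est h now s i j r
          - real (length (filter (in_range (clock now s) r) (registered h s i j)))\<bar>
          \<le> \<epsilon>sw * real (length (filter (in_range (clock now s) r) (registered h s i j)))"
        if "stream_until now s" for s
      proof -
        have "(1 - \<epsilon>sw) * real (length (filter (in_range (clock now s) r) (registered h s i j)))
              \<le> ecm_counter est h now s i j r"
          and "ecm_counter est h now s i j r
              \<le> (1 + \<epsilon>sw) * real (length (filter (in_range (clock now s) r) (registered h s i j)))"
          using assms(5,9) valid_history_registered[OF that, of h i j]
          unfolding exponential_histogram_def ecm_counter_def Let_def by blast+
        then show ?thesis by (simp add: abs_le_iff algebra_simps)
      qed
      show "\<bar>ecm_counter est h now a i j r - n i\<bar> \<le> \<epsilon>sw * n i"
        using cnt[OF assms(7)] by (simp add: registered_in_range_eq_freq[OF D(1,2)] n_def f_def)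
      show "\<bar>ecm_counter est h now b i j r - m i\<bar> \<le> \<epsilon>sw * m i"
        using cnt[OF assms(8)] by (simp add: registered_in_range_eq_freq[OF D(1,3)] m_def g_def)
    qed
    then have "\<bar>\<Sum>i=1..w. ecm_counter est h now a i j r * ecm_counter est h now b i j r - n i * m i\<bar>
        \<le> (\<Sum>i=1..w. c * (n i * m i))"
      by (intro order_trans[OF sum_abs] sum_mono)
    then show ?thesis
      unfolding S_def sum_subtractf T by (simp only: T flip: sum_distrib_left)
  qed

  have fail: "h j \<in> A"
    if hD: "h \<in> space (hash_draws d F)" and j: "j \<in> {1..d}"
      and t: "t \<le> \<bar>(MIN j\<in>{1..d}. S h j) - I\<bar>" for h j
  proof -
    have sp: "h k \<in> space F" if "k \<in> {1..d}" for k
      using hD that by (auto simp: hash_draws_def space_PiM)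
    have X0: "0 \<le> X k" for k unfolding X_def by (intro collision_weight_nonneg f g)
    have XM: "I + X k \<le> M" for k
      unfolding I_def X_def M_def by (intro diagonal_plus_collision_weight_le D f g)
    have cI: "c * (I + X k) \<le> c * M" for k using XM c by simp
    have tM: "t = c * M + \<epsilon>cm * (1 + \<epsilon>sw)\<^sup>2 * M" by (simp add: t_def algebra_simps)
    have pos: "0 < \<epsilon>cm * (1 + \<epsilon>sw)\<^sup>2 * M" using assms(1,4) M by simp
    \<comment> \<open>No row underestimates by \<open>t\<close>: \<open>S h k - I\<close> is at
      least \<open>X (h k) - c * (I + X (h k))\<close>, hence at least \<open>- c * M\<close>, which
      exceeds \<open>- t\<close>.\<close>
    have low: "- t < S h k - I" if "k \<in> {1..d}" for k
      using row[of h k, OF sp[OF that]] X0[of "h k"] cI[of "h k"] tM pos by linarith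
    have "(MIN j\<in>{1..d}. S h j) \<in> S h ` {1..d}" using d by (intro Min_in) auto
    then have "- t < (MIN j\<in>{1..d}. S h j) - I" using low by auto
    moreover have "(MIN j\<in>{1..d}. S h j) \<le> S h j" using j by (intro Min_le) auto
    \<comment> \<open>The deviation of the minimum is thus an overestimate, shared by every
      row.\<close>
    ultimately have "t \<le> S h j - I" using t by linarith
    also have "\<dots> \<le> c * I + (1 + c) * X (h j)"
      using row[of h j, OF sp[OF j]] by (simp add: algebra_simps abs_le_iff)
    also have "\<dots> \<le> c * M + (1 + c) * X (h j)" using XM[of "h j"] X0[of "h j"] c by simp
    \<comment> \<open>The term \<open>c * M\<close> of \<open>t\<close> cancels; the rest of
      \<open>t\<close> is \<open>(1 + c) * (\<epsilon>cm * M)\<close> by \<open>c1\<close>.\<close>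
    finally have "(1 + c) * (\<epsilon>cm * M) \<le> (1 + c) * X (h j)" by (simp add: tM c1 algebra_simps)
    then show ?thesis using c sp[OF j] by (simp add: A_def)
  qed

  have A: "A \<in> sets F"
    unfolding A_def X_def using collision_weight_borel_measurable[OF F] by measurable
  interpret H: prob_space "hash_draws d F"
    unfolding hash_draws_def by (intro prob_space_PiM pF)
  \<comment> \<open>Monotonicity asks for measurability of the larger event only, which is the box
    of bad rows.\<close>
  have "\<P>(h in hash_draws d F. t \<le> \<bar>(MIN j\<in>{1..d}. S h j) - I\<bar>)
      \<le> H.prob {h \<in> space (hash_draws d F). \<forall>j\<in>{1..d}. h j \<in> A}"
    using fail by (intro H.finite_measure_mono prob_all_draws(1)[OF pF A]) auto
  also have "\<dots> = measure F A ^ d" by (rule prob_all_draws(2)[OF pF A])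
  also have "\<dots> \<le> exp (- 1) ^ d"
    unfolding A_def X_def M_def
    using collision_weight_tail[OF F D(1) f g assms(1)] M exp_le_mult_sketch_width[OF assms(1)]
    by (intro power_mono) (auto simp: M_def w_def)
  also have "\<dots> \<le> \<delta>cm" unfolding d_def by (rule exp_minus_one_power_sketch_depth_le[OF assms(2)])
  finally show ?thesis
    by (simp add: inner_product_estimate_def S_def I t_def c_def M_def norms w_def d_def mult.assoc)
qed

end
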